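(* Let $\mathcal F$ be a family of finite graphs with bounded doubling dimension. There is a constant $C$, depending only on $\mathcal F$, such that the following holds. Let $G_1=(V,E_1)\in\mathcal F$ be connected with $|V|=n\ge 3$, let $G_2=(V,E_2)$ be an undirected cycle on the same vertex set $V$, let $\pi$ be a uniformly random permutation of $V$, and let $G$ be the random double clustering graph formed from $G_1$, $G_2$ and $\pi$. Then for any two vertices $x,z\in V$, the path through $G$ from $x$ to $z$ followed by half-greedy routing with respect to $d_1$ has expected length at most $C(\log n)^2$ (that is, expected length $O(\log^2 n)$).
   Context: Bounded doubling dimension: for a graph $G=(V,E)$ with graph (geodesic) distance $\mathrm{dist}$, let $B_r(v)=\{y\in V:\mathrm{dist}(v,y)\le r\}$. A family of graphs has bounded doubling dimension if there is a constant $c$ such that for all $G=(V,E)$ in the family, all $u,v\in V$ and all $r\ge 1$: $B_r(u)\subset B_{2r}(v)\Rightarrow |B_{2r}(v)|\le c\,|B_r(u)|$. Random double clustering graph: given graphs $G_1=(V,E_1)$ and $G_2=(V,E_2)$ with graph distances $d_1$ and $d_2$, and a permutation $\pi$ of $V$, it is the directed graph $G$ on $V$ in which, for distinct $u,v\in V$, there is an edge from $u$ to $v$ if and only if for all $w\in V\setminus\{u,v\}$: $d_1(u,w)<d_1(u,v)\Rightarrow d_2(\pi(u),\pi(w))\ge d_2(\pi(u),\pi(v))$. In particular $G$ contains every edge of $G_1$ (in both directions). Routing uses outgoing edges of $G$. Half-greedy routing with respect to $d_1$, with target $z$: when at a vertex $x\neq z$, if some (out-)neighbor $w$ of $x$ in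 $G$ satisfies $d_1(x,z)>2\,d_1(w,z)$, then such a $w$ is chosen as the next vertex. If no such $w$ exists, the next vertex is a neighbor $w'$ of $x$ in $G_1$ with $d_1(w',z)=d_1(x,z)-1$, chosen among all such $w'$ by some fixed deterministic rule (not depending on $\pi$). Routing stops on reaching $z$; the length of the path is the number of steps. *)

theory Defs
  imports "HOL-Probability.Probability_Mass_Function" "Graph_Theory.Graph_Theory"
begin

text \<open>
  A finite simple undirected graph is a symmetric loop-free finite digraph
  (\<^locale>\<open>pair_graph\<close>). The geodesic distance is the shortest-path function
  of the library for unit arc weights; it is infinite between different components.
\<close>

definition gdist :: "'a pair_pre_digraph \<Rightarrow> 'a \<Rightarrow> 'a \<Rightarrow> ereal" where
  "gdist G u v = wf_digraph.\<mu> (with_proj G) (\<lambda>_. 1) u v"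

definition gball :: "'a pair_pre_digraph \<Rightarrow> nat \<Rightarrow> 'a \<Rightarrow> 'a set" where
  "gball G r v = {y \<in> pverts G. gdist G v y \<le> ereal (real r)}"

text \<open>
  Distances are integers (or infinite), so only integer radii are considered. The condition for
  all real radii implies this one; conversely, this one implies the condition for real radii
  with a larger constant.
\<close>

definition bounded_doubling_dimension :: "'a pair_pre_digraph set \<Rightarrow> bool" where
  "bounded_doubling_dimension F \<longleftrightarrow>
    (\<exists>c::real. \<forall>G\<in>F. \<forall>u\<in>pverts G. \<forall>v\<in>pverts G. \<forall>r\<ge>1.
      gball G r u \<subseteq> gball G (2 * r) v \<longrightarrow>
      real (card (gball G (2 * r) v)) \<le> c * real (card (gball G r u)))"

definition cycle_graph :: "'a pair_pre_digraph \<Rightarrow> bool" where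
  "cycle_graph G \<longleftrightarrow>
    (\<exists>vs. distinct vs \<and> 3 \<le> length vs \<and> pverts G = set vs \<and>
      parcs G = (\<Union>i<length vs. {(vs ! i, vs ! (Suc i mod length vs)),
                                  (vs ! (Suc i mod length vs), vs ! i)}))"

text \<open>The common vertex set is read off from the first graph.\<close>

definition double_clustering_graph ::
  "'a pair_pre_digraph \<Rightarrow> 'a pair_pre_digraph \<Rightarrow> ('a \<Rightarrow> 'a) \<Rightarrow> 'a pair_pre_digraph" where
  "double_clustering_graph G1 G2 \<pi> =
    \<lparr> pverts = pverts G1,
      parcs = {(u, v). u \<in> pverts G1 \<and> v \<in> pverts G1 \<and> u \<noteq> v \<and>
        (\<forall>w \<in> pverts G1 - {u, v}. gdist G1 u w < gdist G1 u v \<longrightarrow>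
           gdist G2 (\<pi> u) (\<pi> w) \<ge> gdist G2 (\<pi> u) (\<pi> v))} \<rparr>"

text \<open>
  A fallback rule \<open>nxt\<close> prescribes the step \<open>nxt x z\<close> along an edge of \<open>G1\<close> that is taken
  at \<open>x\<close> with target \<open>z\<close> when no distance-halving out-neighbour is available.
\<close>

definition fallback_rule :: "'a pair_pre_digraph \<Rightarrow> ('a \<Rightarrow> 'a \<Rightarrow> 'a) \<Rightarrow> bool" where
  "fallback_rule G1 nxt \<longleftrightarrow>
    (\<forall>x\<in>pverts G1. \<forall>z\<in>pverts G1. x \<noteq> z \<longrightarrow>
      (x, nxt x z) \<in> parcs G1 \<and> gdist G1 (nxt x z) z = gdist G1 x z - 1)"

definition halving_neighbour ::
  "'a pair_pre_digraph \<Rightarrow> 'a pair_pre_digraph \<Rightarrow> 'a \<Rightarrow> 'a \<Rightarrow> 'a \<Rightarrow> bool" where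
  "halving_neighbour G1 G z x w \<longleftrightarrow>
    (x, w) \<in> parcs G \<and> gdist G1 x z > 2 * gdist G1 w z"

text \<open>
  \<open>half_greedy_path G1 G nxt z p\<close>: the vertex list \<open>p\<close> is a run of half-greedy routing through
  \<open>G\<close> that ends on first reaching \<open>z\<close>. Which of several halving neighbours is used is left open,
  so there may be several runs from the same start; without a halving neighbour the step is forced.
\<close>

inductive half_greedy_path ::
  "'a pair_pre_digraph \<Rightarrow> 'a pair_pre_digraph \<Rightarrow> ('a \<Rightarrow> 'a \<Rightarrow> 'a) \<Rightarrow> 'a \<Rightarrow> 'a list \<Rightarrow> bool"
  for G1 G nxt z where
  stop: "half_greedy_path G1 G nxt z [z]"
| halve: "\<lbrakk>x \<noteq> z; halving_neighbour G1 G z x w; half_greedy_path G1 G nxt z (w # p)\<rbrakk>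
    \<Longrightarrow> half_greedy_path G1 G nxt z (x # w # p)"
| fallback: "\<lbrakk>x \<noteq> z; \<not> (\<exists>w. halving_neighbour G1 G z x w);
      half_greedy_path G1 G nxt z (nxt x z # p)\<rbrakk>
    \<Longrightarrow> half_greedy_path G1 G nxt z (x # nxt x z # p)"

end

theory Submission
  imports Defs
begin

text \<open>
  Why the expected length is polylogarithmic. Every step decreases the distance to the target \<open>z\<close>,
  and a halving step at least halves it, so there are at most about \<open>log\<^sub>2 n\<close> halving steps. It
  remains to bound the runs of consecutive fallback steps. Without halving, the route from a vertex
  \<open>y\<close> follows a path that is determined by \<open>y\<close> and \<open>z\<close> alone (\<open>descent\<close>), not by the
  permutation. Call \<open>y\<close> stuck if none of the first \<open>K\<close> vertices of this path has a halving
  neighbour. If every vertex at distance more than \<open>D0 = O(K)\<close> from \<open>z\<close> is stuck with probability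
  at most \<open>1 / n\<^sup>2\<close>, then by the union bound none of them is stuck with probability at least
  \<open>1 - 1 / n\<close>. In that case the route has length \<open>O(K log n)\<close>, including at most \<open>D0\<close> steps
  near \<open>z\<close>; otherwise its length is less than \<open>n\<close>, which adds at most 1 to the expectation.
  Because the union bound covers all starting points at once, it does not matter how the choice
  among several halving neighbours depends on the permutation. Since \<open>K = O(log n)\<close> will
  do, the bound \<open>O(log\<^sup>2 n)\<close> follows.

  Why being stuck is exponentially unlikely in \<open>K\<close> (\<open>card_stuck_le\<close>). Let \<open>D\<close> be the distance
  from \<open>y\<close> to \<open>z\<close>, large compared with \<open>K\<close>. With \<open>r\<close> about \<open>D / 4\<close>, let \<open>T\<close> be the ball of
  radius \<open>r\<close> and \<open>A\<close> the ball of radius \<open>16 r\<close> around \<open>z\<close>. Reaching \<open>T\<close> from any of the \<open>K\<close>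
  vertices at least halves the distance, and \<open>A\<close> contains everything that is as close to one of
  these vertices as the points of \<open>T\<close> are. Hence, if the element of \<open>A\<close> other than \<open>x\<close> whose position on
  the cycle is nearest to that of \<open>x\<close> lies in \<open>T\<close>, it is an out-neighbour of \<open>x\<close> and a halving one. The
  doubling condition, used four times, says that \<open>T\<close> is a constant fraction of \<open>A\<close>. Fix the
  permutation outside \<open>A\<close> and the set of positions that \<open>A\<close> occupies; the arrangement of \<open>A\<close> on
  these positions is then uniformly random (\<open>card_permutes_by_cosets\<close>). Expose it step by step: the
  position of \<open>x\<close>, then the element at the nearest position. At most \<open>2 K\<close> of the more than \<open>D\<close>
  elements are exposed in total, and a position of the cycle is the nearest one for at most two
  others, so with probability at least one half the nearest position is still unexposed, and then
  its element lies in \<open>T\<close> with constant probability. This gives a geometric bound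
  (\<open>card_missing_perms\<close>).
\<close>

section \<open>Random arrangements that avoid a dense set of nearest points\<close>

text \<open>
  Composing with the inverse of one permutation of the family turns the prescribed values into fixed
  points, and leaves permutations of the complement.
\<close>

lemma card_permutes_agreeing_le:
  assumes A: "finite A" and L: "L \<subseteq> A"
  shows "card {\<tau>. \<tau> permutes A \<and> (\<forall>l\<in>L. \<tau> l = g l)} \<le> fact (card A - card L)"
proof (cases "{\<tau>. \<tau> permutes A \<and> (\<forall>l\<in>L. \<tau> l = g l)} = {}")
  case True
  then show ?thesis by (metis card.empty zero_le)
next
  case False
  then obtain \<sigma> where \<sigma>: "\<sigma> permutes A" "\<forall>l\<in>L. \<sigma> l = g l" by blast
  let ?S = "{\<tau>. \<tau> permutes A \<and> (\<forall>l\<in>L. \<tau> l = g l)}"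
  have "inj_on (\<lambda>\<tau>. inv \<sigma> \<circ> \<tau>) ?S"
  proof (rule inj_onI)
    fix \<tau> \<tau>' assume "inv \<sigma> \<circ> \<tau> = inv \<sigma> \<circ> \<tau>'"
    then have "\<sigma> \<circ> (inv \<sigma> \<circ> \<tau>) = \<sigma> \<circ> (inv \<sigma> \<circ> \<tau>')" by simp
    then show "\<tau> = \<tau>'" using permutes_inv_o(1)[OF \<sigma>(1)] by (simp add: comp_assoc[symmetric])
  qed
  moreover have "(\<lambda>\<tau>. inv \<sigma> \<circ> \<tau>) ` ?S \<subseteq> {\<rho>. \<rho> permutes (A - L)}"
  proof safe
    fix \<tau> assume \<tau>: "\<tau> permutes A" "\<forall>l\<in>L. \<tau> l = g l"
    have "inv \<sigma> \<circ> \<tau> permutes A"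
      using \<tau>(1) \<sigma>(1) by (intro permutes_compose permutes_inv)
    moreover have "(inv \<sigma> \<circ> \<tau>) l = l" if "l \<in> L" for l
      using that \<sigma> \<tau> by (metis comp_apply permutes_inverses(2))
    ultimately show "inv \<sigma> \<circ> \<tau> permutes (A - L)"
      by (rule permutes_superset) (metis DiffD1 DiffD2 DiffI)
  qed
  ultimately have "card ?S \<le> card {\<rho>. \<rho> permutes (A - L)}"
    using A by (intro card_inj_on_le[of "\<lambda>\<tau>. inv \<sigma> \<circ> \<tau>"]) (auto intro: finite_permutations)
  also have "\<dots> = fact (card A - card L)"
    using A L by (subst card_permutations[OF refl]) (auto simp: card_Diff_subset finite_subset)
  finally show ?thesis .
qed

text \<open>
  Here \<open>A\<close> serves both as the set of positions and as the set of elements placed on them: \<open>\<tau> x\<close>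
  is the position of \<open>x\<close>, and \<open>inv \<tau> (nn (\<tau> x))\<close> is the element at the position nearest to
  \<open>x\<close>. The values of the arrangement on \<open>L\<close> have been exposed to be those of \<open>g\<close>, and the elements
  of \<open>X\<close> that are not exposed yet all miss \<open>T\<close>.
\<close>

definition missing_perms ::
  "'a set \<Rightarrow> 'a set \<Rightarrow> ('a \<Rightarrow> 'a) \<Rightarrow> 'a set \<Rightarrow> 'a set \<Rightarrow> ('a \<Rightarrow> 'a) \<Rightarrow> ('a \<Rightarrow> 'a) set" where
  "missing_perms A T nn X L g = {\<tau>. \<tau> permutes A \<and> (\<forall>l\<in>L. \<tau> l = g l) \<and>
     (\<forall>x\<in>X - L. inv \<tau> (nn (\<tau> x)) \<notin> T)}"

text \<open>
  The induction is on the number of elements of \<open>X\<close> that are not exposed. One step exposes the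
  position \<open>p\<close> of such an element \<open>x\<close> and, if \<open>nn p\<close> is vacant, the element placed there. This
  exposes at most two elements and uses up at least one element of \<open>X\<close>, so the budget \<open>B\<close> is
  respected. The element at \<open>nn p\<close> may itself belong to \<open>X\<close>; then two elements of \<open>X\<close> are used up
  at once, and the induction hypothesis only supplies \<open>\<rho> ^ (k - 2)\<close>. The rate \<open>\<rho>\<close> is close enough
  to 1 to pay for this: what has to hold is \<open>\<rho> / 2 + (1 - t) / 2 \<le> \<rho>\<^sup>2\<close>.
\<close>

lemma card_missing_perms_exposed:
  fixes A T X :: "'a set" and nn :: "'a \<Rightarrow> 'a" and t \<rho> :: real
  assumes A: "finite A" and nn: "\<And>p. p \<in> A \<Longrightarrow> nn p \<in> A \<and> nn p \<noteq> p"
    and fibre: "\<And>q. q \<in> A \<Longrightarrow> card {p \<in> A. nn p = q} \<le> 2"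
    and T: "T \<subseteq> A" and X: "X \<subseteq> A"
    and t: "0 \<le> t" "t \<le> 1" and \<rho>: "\<rho> = 1 - t / 4"
    and B: "5 * B \<le> card A" and TB: "t * card A + B + 1 \<le> card T"
    and L: "L \<subseteq> A" "card L + 2 * card (X - L) \<le> B"
  shows "card (missing_perms A T nn X L g) \<le> \<rho> ^ card (X - L) * fact (card A - card L)"
  using L
proof (induction "card (X - L)" arbitrary: L g rule: less_induct)
  case less
  let ?M = "missing_perms A T nn X L g"
  have finM: "finite (missing_perms A T nn X L' g')" for L' g'
    using finite_permutations[OF A] by (rule finite_subset[rotated]) (auto simp: missing_perms_def)
  have finL: "finite L" using A less.prems(1) finite_subset by blast
  have finX: "finite X" using A X finite_subset by blast
  have \<rho>01: "0 < \<rho>" "\<rho> \<le> 1" using t \<rho> by auto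
  consider "X - L = {}" | "?M = {}" | x \<tau>0 where "x \<in> X" "x \<notin> L" "\<tau>0 \<in> ?M" by blast
  then show ?case
  proof cases
    case 1
    have "card ?M \<le> card {\<tau>. \<tau> permutes A \<and> (\<forall>l\<in>L. \<tau> l = g l)}"
      by (intro card_mono finite_subset[OF _ finite_permutations[OF A]])
        (auto simp: missing_perms_def)
    also have "\<dots> \<le> fact (card A - card L)"
      using card_permutes_agreeing_le[OF A less.prems(1)] .
    finally have "real (card ?M) \<le> real (fact (card A - card L))" using of_nat_le_iff by blast
    then show ?thesis using arg_cong[OF 1, of card] by simp
  next
    case 2
    then show ?thesis using \<rho>01 by simp
  next
    case 3
    define k l N where "k = card (X - L)" and "l = card L" and "N = card A"
    have k: "0 < k" unfolding k_def using 3 finX by (auto simp: card_gt_0_iff)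
    have lB: "l + 2 * k \<le> B" "5 * B \<le> N" using less.prems B by (auto simp: k_def l_def N_def)
    have g: "g ` L = \<tau>0 ` L" and \<tau>0: "\<tau>0 permutes A"
      using 3(3) by (auto simp: missing_perms_def)
    have gL: "g ` L \<subseteq> A" "card (g ` L) = l"
      using less.prems(1) permutes_in_image[OF \<tau>0] permutes_inj[OF \<tau>0]
      by (auto simp: g l_def intro!: card_image inj_on_subset[OF permutes_inj[OF \<tau>0]])
    have xA: "x \<in> A" using 3 X by auto
    \<comment> \<open>Positions for \<open>x\<close> whose nearest position is occupied count as a failure for \<open>x\<close>;
      at the other positions the element on the nearest position must avoid \<open>T\<close>, hence lies in \<open>Y\<close>.\<close>
    define P1 where "P1 = {p \<in> A - g ` L. nn p \<in> g ` L}"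
    define P2 where "P2 = {p \<in> A - g ` L. nn p \<notin> g ` L}"
    define Y where "Y = A - T - L - {x}"
    have fin: "finite P1" "finite P2" "finite Y" using A by (auto simp: P1_def P2_def Y_def)
    let ?M1 = "\<lambda>p. missing_perms A T nn X (insert x L) (g(x := p))"
    let ?M2 = "\<lambda>p y. missing_perms A T nn X (insert y (insert x L)) (g(x := p, y := nn p))"
    have cover: "?M \<subseteq> (\<Union>p\<in>P1. ?M1 p) \<union> (\<Union>p\<in>P2. \<Union>y\<in>Y. ?M2 p y)"
    proof
      fix \<tau> assume \<tau>: "\<tau> \<in> ?M"
      then have perm: "\<tau> permutes A" and ag: "\<And>l. l \<in> L \<Longrightarrow> \<tau> l = g l"
        and miss: "\<And>x. x \<in> X - L \<Longrightarrow> inv \<tau> (nn (\<tau> x)) \<notin> T"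
        by (auto simp: missing_perms_def)
      have pA: "\<tau> x \<in> A" using xA perm by (simp add: permutes_in_image)
      have "\<tau> x \<notin> g ` L"
        using 3(2) ag permutes_inj[OF perm] by (metis imageE injD)
      then have pP: "\<tau> x \<in> P1 \<or> \<tau> x \<in> P2" using pA by (auto simp: P1_def P2_def)
      show "\<tau> \<in> (\<Union>p\<in>P1. ?M1 p) \<union> (\<Union>p\<in>P2. \<Union>y\<in>Y. ?M2 p y)"
      proof (cases "\<tau> x \<in> P1")
        case True
        have "\<tau> \<in> ?M1 (\<tau> x)" using perm ag miss by (auto simp: missing_perms_def)
        then show ?thesis using True by blast
      next
        case False
        then have P2: "\<tau> x \<in> P2" using pP by simp
        define y where "y = inv \<tau> (nn (\<tau> x))"
        have \<tau>y: "\<tau> y = nn (\<tau> x)" using permutes_inverses(1)[OF perm] by (simp add: y_def)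
        have "y \<noteq> x" using \<tau>y nn[OF pA] by auto
        moreover have "y \<notin> L"
        proof
          assume "y \<in> L"
          then have "nn (\<tau> x) \<in> g ` L" using \<tau>y ag by (metis imageI)
          then show False using P2 by (simp add: P2_def)
        qed
        moreover have "y \<in> A" using \<tau>y nn[OF pA] permutes_in_image[OF perm] by metis
        moreover have "y \<notin> T" using miss 3 by (auto simp: y_def)
        ultimately have "y \<in> Y" by (auto simp: Y_def)
        moreover have "\<tau> \<in> ?M2 (\<tau> x) y"
          unfolding missing_perms_def
        proof (intro CollectI conjI ballI)
          fix l assume "l \<in> insert y (insert x L)"
          then show "\<tau> l = (g(x := \<tau> x, y := nn (\<tau> x))) l"
            using \<tau>y ag by (cases "l = y"; cases "l = x") simp_all
        qed (use perm miss in simp_all)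
        ultimately show ?thesis using P2 by blast
      qed
    qed
    have L1: "card (insert x L) = Suc l" using finL 3 by (simp add: l_def)
    have k1: "card (X - insert x L) = k - 1"
    proof -
      have "X - insert x L = X - L - {x}" by auto
      then show ?thesis using 3 finX by (simp add: k_def)
    qed
    define F where "F = (fact (N - l - 1) :: real)"
    have b1: "real (card (?M1 p)) \<le> \<rho> ^ (k - 1) * F" for p
    proof -
      have "real (card (?M1 p)) \<le> \<rho> ^ card (X - insert x L) * fact (card A - card (insert x L))"
        using k1 L1 k lB less.prems xA by (intro less.hyps) (auto simp: k_def)
      then show ?thesis by (simp add: k1 L1 F_def N_def)
    qed
    have b2: "real (card (?M2 p y)) \<le> \<rho> ^ k / \<rho>\<^sup>2 * fact (N - l - 2)" if y: "y \<in> Y" for p y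
    proof -
      define k' where "k' = card (X - insert y (insert x L))"
      have L2: "card (insert y (insert x L)) = Suc (Suc l)"
        using finL L1 y by (auto simp: Y_def)
      have k': "k' < k"
        unfolding k'_def k_def using 3 finX by (intro psubset_card_mono) auto
      have "X - insert y (insert x L) = X - insert x L - {y}" by auto
      then have "k' \<ge> k - 1 - 1"
        unfolding k'_def using k1 by (metis diff_card_le_card_Diff finite.emptyI finite.insertI
          card.empty card_insert_disjoint empty_iff One_nat_def)
      then have k'2: "k \<le> k' + 2" by simp
      have "real (card (?M2 p y)) \<le> \<rho> ^ k' * fact (card A - card (insert y (insert x L)))"
        unfolding k'_def using k' L2 lB less.prems xA y
        by (intro less.hyps) (auto simp: k_def k'_def Y_def)
      also have "\<dots> = \<rho> ^ (k' + 2) / \<rho>\<^sup>2 * fact (N - l - 2)"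
        using \<rho>01 by (simp add: L2 N_def power_add power2_eq_square)
      also have "\<dots> \<le> \<rho> ^ k / \<rho>\<^sup>2 * fact (N - l - 2)"
        using \<rho>01 power_decreasing[OF k'2, of \<rho>] by (intro mult_right_mono divide_right_mono) auto
      finally show ?thesis .
    qed
    have cardY: "real (card Y) \<le> (1 - t) * real (N - l - 1)"
    proof -
      have "card Y \<le> card (A - T)" using A by (intro card_mono) (auto simp: Y_def)
      also have "\<dots> = N - card T" using A T by (simp add: card_Diff_subset finite_subset N_def)
      finally have "real (card Y) \<le> real N - real (card T)"
        using card_mono[OF A T] by (simp add: N_def)
      also have "\<dots> \<le> real N - t * real N - (real l + 1)"
        using TB lB by (simp add: N_def)
      also have "\<dots> \<le> real N - t * real N - (1 - t) * (real l + 1)"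
        using t by (simp add: algebra_simps)
      also have "\<dots> = (1 - t) * real (N - l - 1)"
        using lB k by (simp add: of_nat_diff algebra_simps)
      finally show ?thesis .
    qed
    have F2: "real (N - l - 1) * fact (N - l - 2) = F"
    proof -
      have "N - l - 1 = Suc (N - l - 2)" using lB k by simp
      then show ?thesis unfolding F_def by (simp del: of_nat_Suc)
    qed
    have FN: "real (N - l) * F = fact (N - l)"
    proof -
      have "N - l = Suc (N - l - 1)" using lB k by simp
      then show ?thesis unfolding F_def by (metis fact_Suc)
    qed
    have F0: "F > 0" by (simp add: F_def)
    have cP: "card P1 + card P2 = N - l"
    proof -
      have "card P1 + card P2 = card (P1 \<union> P2)"
        using fin by (subst card_Un_disjoint) (auto simp: P1_def P2_def)
      also have "P1 \<union> P2 = A - g ` L" by (auto simp: P1_def P2_def)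
      also have "card (A - g ` L) = N - l"
        using gL finL by (simp add: card_Diff_subset N_def)
      finally show ?thesis .
    qed
    have cP1: "card P1 \<le> 2 * l"
    proof -
      have "P1 \<subseteq> (\<Union>q\<in>g ` L. {p \<in> A. nn p = q})" by (auto simp: P1_def)
      then have "card P1 \<le> card (\<Union>q\<in>g ` L. {p \<in> A. nn p = q})"
        using A finL by (intro card_mono) auto
      also have "\<dots> \<le> (\<Sum>q\<in>g ` L. card {p \<in> A. nn p = q})"
        using finL by (intro card_UN_le) auto
      also have "\<dots> \<le> (\<Sum>q\<in>g ` L. 2)" using gL by (intro sum_mono fibre) auto
      finally show ?thesis using gL by simp
    qed
    have "card ?M \<le> card ((\<Union>p\<in>P1. ?M1 p) \<union> (\<Union>p\<in>P2. \<Union>y\<in>Y. ?M2 p y))"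
      using fin finM by (intro card_mono cover) auto
    also have "\<dots> \<le> card (\<Union>p\<in>P1. ?M1 p) + card (\<Union>p\<in>P2. \<Union>y\<in>Y. ?M2 p y)"
      by (rule card_Un_le)
    also have "\<dots> \<le> (\<Sum>p\<in>P1. card (?M1 p)) + (\<Sum>p\<in>P2. \<Sum>y\<in>Y. card (?M2 p y))"
      using fin by (intro add_mono card_UN_le order.trans[OF card_UN_le sum_mono]) auto
    finally have "real (card ?M) \<le> (\<Sum>p\<in>P1. real (card (?M1 p))) + (\<Sum>p\<in>P2. \<Sum>y\<in>Y. real (card (?M2 p y)))"
      by (metis (mono_tags, lifting) of_nat_add of_nat_le_iff of_nat_sum sum.cong)
    also have "\<dots> \<le> (\<Sum>p\<in>P1. \<rho> ^ (k - 1) * F) + (\<Sum>p\<in>P2. \<Sum>y\<in>Y. \<rho> ^ k / \<rho>\<^sup>2 * fact (N - l - 2))"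
      using b1 b2 by (intro add_mono sum_mono) auto
    also have "\<dots> = card P1 * (\<rho> ^ k / \<rho> * F) + card P2 * (\<rho> ^ k / \<rho>\<^sup>2 * (real (card Y) * fact (N - l - 2)))"
      using k \<rho>01 by (simp add: power_diff algebra_simps)
    also have "\<dots> \<le> card P1 * (\<rho> ^ k / \<rho> * F) + card P2 * (\<rho> ^ k / \<rho>\<^sup>2 * ((1 - t) * F))"
    proof -
      have "real (card Y) * fact (N - l - 2) \<le> (1 - t) * real (N - l - 1) * fact (N - l - 2)"
        using cardY by (intro mult_right_mono) auto
      also have "\<dots> = (1 - t) * F" using F2 by (simp add: mult.assoc)
      finally show ?thesis using \<rho>01 by (intro add_mono mult_left_mono) auto
    qed
    also have "\<dots> = \<rho> ^ k * F / \<rho>\<^sup>2 * (card P1 * \<rho> + card P2 * (1 - t))"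
      using \<rho>01 by (simp add: field_simps power2_eq_square)
    also have "\<dots> \<le> \<rho> ^ k * F / \<rho>\<^sup>2 * (real (N - l) * \<rho>\<^sup>2)"
    proof (intro mult_left_mono)
      \<comment> \<open>Weight can only be gained by moving it to \<open>P1\<close>, and \<open>P1\<close> has at most half of it:
        \<open>2 * (2 * l) \<le> N - l\<close> because \<open>5 * l \<le> N\<close>.\<close>
      have half: "2 * real (card P1) \<le> real (N - l)" using cP1 lB by linarith
      have P2eq: "real (card P2) = real (N - l) - real (card P1)" using cP by linarith
      have "card P1 * \<rho> + card P2 * (1 - t) = real (N - l) * (1 - t) + real (card P1) * (\<rho> - (1 - t))"
        unfolding P2eq by (simp add: algebra_simps)
      also have "\<dots> \<le> real (N - l) * (1 - t) + real (N - l) / 2 * (\<rho> - (1 - t))"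
        using half t \<rho> by (intro add_mono mult_right_mono) auto
      also have "\<dots> = real (N - l) * (1 - 5 * t / 8)" by (simp add: \<rho> algebra_simps)
      also have "\<dots> \<le> real (N - l) * \<rho>\<^sup>2"
        using t by (intro mult_left_mono) (auto simp: \<rho> power2_eq_square algebra_simps)
      finally show "card P1 * \<rho> + card P2 * (1 - t) \<le> real (N - l) * \<rho>\<^sup>2" .
    qed (use \<rho>01 F0 in auto)
    also have "\<dots> = \<rho> ^ k * (real (N - l) * F)" using \<rho>01 by simp
    also have "\<dots> = \<rho> ^ k * fact (N - l)" by (simp only: FN)
    finally show ?thesis by (simp only: k_def l_def N_def)
  qed
qed

lemma card_missing_perms:
  fixes A T X :: "'a set" and nn :: "'a \<Rightarrow> 'a" and t :: real
  assumes "finite A" and "\<And>p. p \<in> A \<Longrightarrow> nn p \<in> A \<and> nn p \<noteq> p"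
    and "\<And>q. q \<in> A \<Longrightarrow> card {p \<in> A. nn p = q} \<le> 2"
    and "T \<subseteq> A" "X \<subseteq> A" "0 \<le> t" "t \<le> 1"
    and "10 * card X \<le> card A" "t * card A + 2 * card X + 1 \<le> card T"
  shows "card {\<tau>. \<tau> permutes A \<and> (\<forall>x\<in>X. inv \<tau> (nn (\<tau> x)) \<notin> T)}
    \<le> (1 - t / 4) ^ card X * fact (card A)"
  using card_missing_perms_exposed[of A nn T X t "1 - t / 4" "2 * card X" "{}" undefined] assms
  by (simp add: missing_perms_def)

text \<open>
  Exposing only part of a random permutation of \<open>V\<close>: composing it with an independent random
  permutation of \<open>A\<close> does not change its distribution, so a bound that holds on average over each
  such family \<open>\<pi> \<circ> \<tau>\<close> holds on average over all permutations.
\<close>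

lemma card_permutes_by_cosets:
  fixes c :: real
  assumes V: "finite V" "A \<subseteq> V"
    and coset: "\<And>\<pi>. \<pi> permutes V \<Longrightarrow> card {\<tau>. \<tau> permutes A \<and> P (\<pi> \<circ> \<tau>)} \<le> c * fact (card A)"
  shows "card {\<pi>. \<pi> permutes V \<and> P \<pi>} \<le> c * fact (card V)"
proof -
  define SV SA where "SV = {\<pi>. \<pi> permutes V}" and "SA = {\<tau>. \<tau> permutes A}"
  have fin: "finite SV" "finite SA"
    using V by (auto simp: SV_def SA_def intro!: finite_permutations intro: finite_subset)
  have cards: "card SV = fact (card V)" "card SA = fact (card A)"
    using V by (auto simp: SV_def SA_def intro!: card_permutations intro: finite_subset)
  have count: "real (card {x \<in> S. Q x}) = (\<Sum>x\<in>S. of_bool (Q x))" if "finite S" for S and Q :: "('a \<Rightarrow> 'a) \<Rightarrow> bool"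
    using that by (simp add: Int_def)
  have shift: "(\<Sum>\<pi>\<in>SV. of_bool (P (\<pi> \<circ> \<tau>))) = (\<Sum>\<pi>\<in>SV. of_bool (P \<pi>) :: real)" if "\<tau> \<in> SA" for \<tau>
  proof -
    have \<tau>: "\<tau> permutes V" using that V permutes_subset by (auto simp: SA_def)
    show ?thesis
      by (rule sum.reindex_bij_witness[of _ "\<lambda>\<pi>. \<pi> \<circ> inv \<tau>" "\<lambda>\<pi>. \<pi> \<circ> \<tau>"])
        (auto simp: SV_def comp_assoc permutes_inv_o[OF \<tau>]
          intro!: permutes_compose[OF \<tau>] permutes_compose[OF permutes_inv[OF \<tau>]])
  qed
  have "real (card SA) * card {\<pi> \<in> SV. P \<pi>} = (\<Sum>\<tau>\<in>SA. \<Sum>\<pi>\<in>SV. of_bool (P (\<pi> \<circ> \<tau>)))"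
    unfolding count[OF fin(1)] by (subst sum.cong[OF refl shift]) auto
  also have "\<dots> = (\<Sum>\<pi>\<in>SV. \<Sum>\<tau>\<in>SA. of_bool (P (\<pi> \<circ> \<tau>)))" by (rule sum.swap)
  also have "\<dots> = (\<Sum>\<pi>\<in>SV. real (card {\<tau> \<in> SA. P (\<pi> \<circ> \<tau>)}))" unfolding count[OF fin(2)] ..
  also have "\<dots> \<le> (\<Sum>\<pi>\<in>SV. c * fact (card A))"
    using coset by (intro sum_mono) (auto simp: SV_def SA_def)
  also have "\<dots> = fact (card A) * (c * fact (card V))" by (simp add: cards)
  finally have "fact (card A) * real (card {\<pi> \<in> SV. P \<pi>}) \<le> fact (card A) * (c * fact (card V))"
    by (simp add: cards)
  then show ?thesis by (simp add: SV_def)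
qed

section \<open>Graph distance by walk lengths\<close>

definition hop :: "'a pair_pre_digraph \<Rightarrow> 'a \<Rightarrow> 'a \<Rightarrow> nat" where
  "hop G u v = (LEAST k. \<exists>p. pre_digraph.awalk (with_proj G) u p v \<and> length p = k)"

context pair_wf_digraph
begin

lemma awalk_cost_unit: "awalk_cost (\<lambda>_. 1) p = real (length p)"
  by (simp add: awalk_cost_def sum_list_triv)

lemma hop_le: "awalk u p v \<Longrightarrow> hop G u v \<le> length p"
  unfolding hop_def by (rule Least_le) auto

lemma hop_awalk:
  assumes "u \<rightarrow>\<^sup>*\<^bsub>with_proj G\<^esub> v"
  obtains p where "awalk u p v" "length p = hop G u v"
proof -
  have "\<exists>k p. awalk u p v \<and> length p = k" using assms by (auto simp: reachable_awalk)
  then have "\<exists>p. awalk u p v \<and> length p = hop G u v" unfolding hop_def by (rule LeastI_ex)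
  then show ?thesis using that by blast
qed

lemma gdist_eq_hop:
  assumes "u \<rightarrow>\<^sup>*\<^bsub>with_proj G\<^esub> v"
  shows "gdist G u v = ereal (real (hop G u v))"
proof -
  obtain p where p: "awalk u p v" "length p = hop G u v" using hop_awalk[OF assms] .
  show ?thesis unfolding gdist_def \<mu>_def awalk_cost_unit
  proof (rule antisym)
    show "(INF p\<in>{p. awalk u p v}. ereal (real (length p))) \<le> ereal (real (hop G u v))"
      using p by (intro INF_lower2[of p]) auto
    show "ereal (real (hop G u v)) \<le> (INF p\<in>{p. awalk u p v}. ereal (real (length p)))"
      by (intro INF_greatest) (auto intro: hop_le)
  qed
qed

lemma hop_triangle:
  assumes "u \<rightarrow>\<^sup>*\<^bsub>with_proj G\<^esub> v" "v \<rightarrow>\<^sup>*\<^bsub>with_proj G\<^esub> w"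
  shows "hop G u w \<le> hop G u v + hop G v w"
proof -
  obtain p q where "awalk u p v" "length p = hop G u v" "awalk v q w" "length q = hop G v w"
    using hop_awalk assms by metis
  then show ?thesis using hop_le[of u "p @ q" w] by auto
qed

end

lemma (in pair_sym_digraph) hop_sym: "hop G u v = hop G v u"
proof -
  have "(\<exists>p. awalk u p v \<and> length p = k) \<longleftrightarrow> (\<exists>p. awalk v p u \<and> length p = k)" for k
  proof -
    have *: "\<exists>p. awalk v p u \<and> length p = k" if "awalk u p v" "length p = k" for u v p
      using that(1) unfolding that(2)[symmetric]
    proof (induction p arbitrary: u)
      case Nil
      then show ?case by (auto simp: awalk_Nil_iff)
    next
      case (Cons e p)
      then obtain q where q: "awalk v q (snd e)" "length q = length p" by (auto simp: awalk_Cons_iff)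
      have e: "e \<in> parcs G" "u = fst e" using Cons.prems by (auto simp: awalk_Cons_iff)
      then have "(snd e, fst e) \<in> parcs G" using arcs_symmetric by (metis prod.collapse)
      then have "awalk (snd e) [(snd e, fst e)] u"
        using e by (auto simp: awalk_simps intro: arc_fst_in_verts)
      then have "awalk v (q @ [(snd e, fst e)]) u" using q by auto
      then show ?case using q by (intro exI[of _ "q @ [(snd e, fst e)]"]) auto
    qed
    show ?thesis using * by blast
  qed
  then show ?thesis unfolding hop_def by simp
qed

section \<open>Nearest points on a cycle\<close>

definition circular_dist :: "nat \<Rightarrow> nat \<Rightarrow> nat \<Rightarrow> int" where
  "circular_dist n i j = min \<bar>int i - int j\<bar> (int n - \<bar>int i - int j\<bar>)"

lemma circular_dist_step:
  assumes "i < n" "j < n" "k = Suc i mod n \<or> i = Suc k mod n" "k < n"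
  shows "circular_dist n i j \<le> 1 + circular_dist n k j"
proof -
  have "Suc i mod n = (if Suc i = n then 0 else Suc i)" "Suc k mod n = (if Suc k = n then 0 else Suc k)"
    using assms by (simp_all add: mod_Suc)
  then consider "k = Suc i" | "i = Suc k" | "k = 0" "Suc i = n" | "i = 0" "Suc k = n"
    using assms(3) by (auto split: if_splits)
  then show ?thesis
  proof cases
    case 1 then show ?thesis using assms(1,2,4) unfolding circular_dist_def by linarith
  next
    case 2 then show ?thesis using assms(1,2,4) unfolding circular_dist_def by linarith
  next
    case 3 then show ?thesis using assms(1,2,4) unfolding circular_dist_def by linarith
  next
    case 4 then show ?thesis using assms(1,2,4) unfolding circular_dist_def by linarith
  qed
qed

text \<open>
  The numbers \<open>a\<close> and \<open>b\<close> are clockwise offsets from a point \<open>q\<close>. On the same half of the circle,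
  the one that is farther from \<open>q\<close> passes the other one on the way to \<open>q\<close>, so \<open>q\<close> is not its
  nearest point. The antipode may be counted on either half.
\<close>

lemma no_two_nearest_on_half_circle:
  fixes a b n :: int
  assumes "0 < a" "a < n" "0 < b" "b < n" "a \<noteq> b"
    and side: "(2 * a \<le> n \<and> 2 * b \<le> n) \<or> (n \<le> 2 * a \<and> n \<le> 2 * b)"
    and "min a (n - a) \<le> \<bar>a - b\<bar>" "min b (n - b) \<le> \<bar>a - b\<bar>"
  shows False
  using assms by linarith

text \<open>
  Of three points, two lie on the same half of the circle as seen from \<open>q\<close>.
\<close>

lemma no_three_nearest_on_circle:
  assumes "a < n" "b < n" "c < n" "q < n"
    and "distinct [a, b, c, q]"
    and "circular_dist n a q \<le> circular_dist n a b" "circular_dist n a q \<le> circular_dist n a c"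
    and "circular_dist n b q \<le> circular_dist n b a" "circular_dist n b q \<le> circular_dist n b c"
    and "circular_dist n c q \<le> circular_dist n c a" "circular_dist n c q \<le> circular_dist n c b"
  shows False
proof -
  define off where "off p = (if q \<le> p then int p - int q else int p - int q + int n)" for p
  have off: "0 < off p" "off p < int n" "min (off p) (int n - off p) \<le> circular_dist n p q"
    if p: "p < n" "p \<noteq> q" for p
  proof -
    consider "q < p" "off p = int p - int q" | "p < q" "off p = int p - int q + int n"
      using p(2) by (cases "q \<le> p") (auto simp: off_def)
    then have "0 < off p \<and> off p < int n \<and> min (off p) (int n - off p) \<le> circular_dist n p q"
      using p(1) assms(4) unfolding circular_dist_def by cases linarith+
    then show "0 < off p" "off p < int n" "min (off p) (int n - off p) \<le> circular_dist n p q"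
      by blast+
  qed
  have off2: "circular_dist n p p' \<le> \<bar>off p - off p'\<bar>" if "p < n" "p' < n" for p p'
    using that assms(4) unfolding off_def circular_dist_def
    by (cases "q \<le> p"; cases "q \<le> p'"; simp only: if_True if_False; linarith)
  have off_inj: "off p \<noteq> off p'" if "p < n" "p' < n" "p \<noteq> p'" for p p'
    using that assms(4) by (auto simp: off_def split: if_splits)
  have opposite: "\<not> ((2 * off p \<le> n \<and> 2 * off p' \<le> n) \<or> (n \<le> 2 * off p \<and> n \<le> 2 * off p'))"
    if p: "p < n" "p' < n" "p \<noteq> p'" "p \<noteq> q" "p' \<noteq> q"
      and near: "circular_dist n p q \<le> circular_dist n p p'" "circular_dist n p' q \<le> circular_dist n p' p"
    for p p'
  proof
    assume side: "(2 * off p \<le> n \<and> 2 * off p' \<le> n) \<or> (n \<le> 2 * off p \<and> n \<le> 2 * off p')"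
    have "min (off p) (int n - off p) \<le> \<bar>off p - off p'\<bar>"
      using off(3)[OF p(1,4)] near(1) off2[OF p(1,2)] by linarith
    moreover have "min (off p') (int n - off p') \<le> \<bar>off p - off p'\<bar>"
      using off(3)[OF p(2,5)] near(2) off2[OF p(2,1)] by linarith
    ultimately show False
      using no_two_nearest_on_half_circle[OF off(1,2)[OF p(1,4)] off(1,2)[OF p(2,5)] off_inj[OF p(1-3)] side]
      by blast
  qed
  have d: "a \<noteq> b" "a \<noteq> c" "b \<noteq> c" "a \<noteq> q" "b \<noteq> q" "c \<noteq> q" using assms(5) by auto
  show ?thesis
    using opposite[OF assms(1,2) d(1,4,5) assms(6,8)] opposite[OF assms(1,3) d(2,4,6) assms(7,10)]
      opposite[OF assms(2,3) d(3,5,6) assms(9,11)] by linarith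
qed

text \<open>
  Going around the cycle in either direction gives walks of the two candidate lengths, and no walk is
  shorter since one step changes the circular distance by at most one.
\<close>

lemma gdist_cycle:
  assumes vs: "distinct vs" "3 \<le> length vs" and V: "pverts G = set vs"
    and E: "parcs G = (\<Union>i<length vs. {(vs ! i, vs ! (Suc i mod length vs)),
                                  (vs ! (Suc i mod length vs), vs ! i)})"
    and i: "i < length vs" and j: "j < length vs"
  shows "gdist G (vs ! i) (vs ! j) = ereal (real_of_int (circular_dist (length vs) i j))"
proof -
  define n where "n = length vs"
  have n: "0 < n" using vs(2) unfolding n_def by linarith
  have succ: "(vs ! i, vs ! (Suc i mod n)) \<in> parcs G" "(vs ! (Suc i mod n), vs ! i) \<in> parcs G"
    if "i < n" for i
    using that unfolding E n_def by blast+
  interpret pair_wf_digraph G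
  proof
    fix e assume "e \<in> parcs G"
    then obtain i where "i < n" and
      e: "e = (vs ! i, vs ! (Suc i mod n)) \<or> e = (vs ! (Suc i mod n), vs ! i)"
      unfolding E n_def by blast
    moreover have "Suc i mod n < n" using n by (rule mod_less_divisor)
    ultimately have "vs ! i \<in> pverts G" "vs ! (Suc i mod n) \<in> pverts G"
      unfolding V n_def by (simp_all only: nth_mem)
    then show "fst e \<in> pverts G" "snd e \<in> pverts G" using e by auto
  qed
  have lower: "circular_dist n i j \<le> length p" if "awalk (vs ! i) p (vs ! j)" "i < n" "j < n" for i j p
    using that
  proof (induction p arbitrary: i)
    case Nil
    then have "i = j" using vs by (simp add: awalk_Nil_iff nth_eq_iff_index_eq n_def)
    then show ?case by (simp add: circular_dist_def)
  next
    case (Cons e p)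
    then have e: "e \<in> parcs G" "fst e = vs ! i" and w: "awalk (snd e) p (vs ! j)"
      by (auto simp: awalk_Cons_iff)
    from e(1) obtain k where k: "k < n" and
      ek: "e = (vs ! k, vs ! (Suc k mod n)) \<or> e = (vs ! (Suc k mod n), vs ! k)"
      unfolding E n_def by blast
    have sk: "Suc k mod n < n" using n by (rule mod_less_divisor)
    obtain k' where k': "snd e = vs ! k'" "k' < n" "k' = Suc i mod n \<or> i = Suc k' mod n"
      using ek
    proof
      assume "e = (vs ! k, vs ! (Suc k mod n))"
      moreover from this have "k = i" using e vs k Cons.prems by (simp add: nth_eq_iff_index_eq n_def)
      ultimately show ?thesis using that sk by auto
    next
      assume "e = (vs ! (Suc k mod n), vs ! k)"
      moreover from this have "Suc k mod n = i"
        using e vs sk Cons.prems by (simp add: nth_eq_iff_index_eq n_def)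
      ultimately show ?thesis using that k by auto
    qed
    have "circular_dist n k' j \<le> length p" using Cons.IH[of k'] w k' Cons.prems by simp
    then show ?case using circular_dist_step[OF Cons.prems(2,3) k'(3,2)] by simp
  qed
  have walk_up: "\<exists>p. awalk (vs ! i) p (vs ! ((i + k) mod n)) \<and> length p = k" if i: "i < n" for i k
  proof (induction k)
    case 0
    have "awalk (vs ! i) [] (vs ! i)" using i V by (simp add: awalk_Nil_iff n_def)
    then show ?case using i by auto
  next
    case (Suc k)
    then obtain p where p: "awalk (vs ! i) p (vs ! ((i + k) mod n))" "length p = k" by blast
    let ?e = "(vs ! ((i + k) mod n), vs ! (Suc ((i + k) mod n) mod n))"
    have "?e \<in> parcs G" using succ n by simp
    then have "awalk (vs ! ((i + k) mod n)) [?e] (vs ! (Suc ((i + k) mod n) mod n))"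
      by (auto simp: awalk_simps dest: in_arcsD1 in_arcsD2)
    then have "awalk (vs ! i) (p @ [?e]) (vs ! ((i + Suc k) mod n))"
      using p by (auto simp: mod_Suc_eq)
    then show ?case using p(2) by (intro exI[of _ "p @ [?e]"]) simp
  qed
  have walk_down: "\<exists>p. awalk (vs ! ((i + k) mod n)) p (vs ! i) \<and> length p = k" if i: "i < n" for i k
  proof (induction k)
    case 0
    have "awalk (vs ! i) [] (vs ! i)" using i V by (simp add: awalk_Nil_iff n_def)
    then show ?case using i by auto
  next
    case (Suc k)
    then obtain p where p: "awalk (vs ! ((i + k) mod n)) p (vs ! i)" "length p = k" by blast
    let ?e = "(vs ! (Suc ((i + k) mod n) mod n), vs ! ((i + k) mod n))"
    have "?e \<in> parcs G" using succ n by simp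
    then have "awalk (vs ! ((i + Suc k) mod n)) (?e # p) (vs ! i)"
      using p by (auto simp: mod_Suc_eq awalk_Cons_iff dest: in_arcsD1)
    then show ?case using p(2) by (intro exI[of _ "?e # p"]) simp
  qed
  have upper: "\<exists>p. awalk (vs ! i) p (vs ! j) \<and> int (length p) = circular_dist n i j"
    if ij: "i < n" "j < n" for i j
  proof -
    have "\<exists>p. awalk (vs ! i) p (vs ! j) \<and> int (length p) = \<bar>int i - int j\<bar>"
    proof (cases "i \<le> j")
      case True
      then show ?thesis using walk_up[of i "j - i"] ij by auto
    next
      case False
      then show ?thesis using walk_down[of j "i - j"] ij by auto
    qed
    moreover have "\<exists>p. awalk (vs ! i) p (vs ! j) \<and> int (length p) = int n - \<bar>int i - int j\<bar>"
    proof (cases "i \<le> j")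
      case True
      then have "(j + (n - (j - i))) mod n = i" using ij by simp
      then show ?thesis using walk_down[of j "n - (j - i)"] ij True by (auto simp: of_nat_diff)
    next
      case False
      then have "(i + (n - (i - j))) mod n = j" using ij by simp
      then show ?thesis using walk_up[of i "n - (i - j)"] ij False by (auto simp: of_nat_diff)
    qed
    ultimately show ?thesis unfolding circular_dist_def min_def by auto
  qed
  have ij: "i < n" "j < n" using i j by (simp_all add: n_def)
  obtain p where p: "awalk (vs ! i) p (vs ! j)" "int (length p) = circular_dist n i j"
    using upper[OF ij] by blast
  have r: "vs ! i \<rightarrow>\<^sup>*\<^bsub>with_proj G\<^esub> vs ! j" using p(1) by (auto simp: reachable_awalk)
  obtain p' where p': "awalk (vs ! i) p' (vs ! j)" "length p' = hop G (vs ! i) (vs ! j)"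
    using hop_awalk[OF r] .
  have "int (hop G (vs ! i) (vs ! j)) = circular_dist n i j"
    using lower[OF p'(1) ij] p' hop_le[OF p(1)] p(2) by simp
  then have "real (hop G (vs ! i) (vs ! j)) = real_of_int (circular_dist n i j)" by linarith
  then show ?thesis unfolding gdist_eq_hop[OF r] by (simp add: n_def)
qed

text \<open>
  Every choice of nearest points works: ties are harmless, since the argument for three points
  compares distances strictly only between points on one half of the circle.
\<close>

lemma nearest_map_on_cycle:
  assumes G: "cycle_graph G" and A: "finite A" "2 \<le> card A"
    and \<pi>: "inj_on \<pi> A" "\<pi> ` A \<subseteq> pverts G"
  obtains nn where "\<And>p. p \<in> A \<Longrightarrow> nn p \<in> A \<and> nn p \<noteq> p"
    and "\<And>p p'. p \<in> A \<Longrightarrow> p' \<in> A \<Longrightarrow> p' \<noteq> p \<Longrightarrow>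
           gdist G (\<pi> p) (\<pi> (nn p)) \<le> gdist G (\<pi> p) (\<pi> p')"
    and "\<And>q. q \<in> A \<Longrightarrow> card {p \<in> A. nn p = q} \<le> 2"
proof -
  obtain vs where vs: "distinct vs" "3 \<le> length vs" "pverts G = set vs"
    "parcs G = (\<Union>i<length vs. {(vs ! i, vs ! (Suc i mod length vs)),
                                  (vs ! (Suc i mod length vs), vs ! i)})"
    using G unfolding cycle_graph_def by blast
  have "\<exists>i<length vs. vs ! i = \<pi> p" if "p \<in> A" for p
    using that \<pi>(2) vs(3) by (metis image_subset_iff in_set_conv_nth)
  then obtain idx where idx: "\<And>p. p \<in> A \<Longrightarrow> idx p < length vs \<and> vs ! idx p = \<pi> p" by metis
  have idx_inj: "idx p \<noteq> idx p'" if "p \<in> A" "p' \<in> A" "p \<noteq> p'" for p p'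
    using that idx \<pi>(1) by (metis inj_on_eq_iff)
  define cd where "cd p p' = circular_dist (length vs) (idx p) (idx p')" for p p'
  have gd: "gdist G (\<pi> p) (\<pi> p') = ereal (real_of_int (cd p p'))" if "p \<in> A" "p' \<in> A" for p p'
    using gdist_cycle[OF vs, of "idx p" "idx p'"] that idx unfolding cd_def by auto
  have "\<exists>q. q \<in> A - {p} \<and> (\<forall>p'\<in>A - {p}. cd p q \<le> cd p p')" if "p \<in> A" for p
  proof -
    have "card (A - {p}) \<ge> 1" using that A by simp
    then have "A - {p} \<noteq> {}" by fastforce
    then show ?thesis using ex_is_arg_min_if_finite[of "A - {p}" "cd p"] A
      by (auto simp: is_arg_min_linorder)
  qed
  then obtain nn where nn: "\<And>p. p \<in> A \<Longrightarrow> nn p \<in> A - {p} \<and> (\<forall>p'\<in>A - {p}. cd p (nn p) \<le> cd p p')"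
    by metis
  show ?thesis
  proof
    show "nn p \<in> A \<and> nn p \<noteq> p" if "p \<in> A" for p using nn[OF that] by auto
    show "gdist G (\<pi> p) (\<pi> (nn p)) \<le> gdist G (\<pi> p) (\<pi> p')" if "p \<in> A" "p' \<in> A" "p' \<noteq> p" for p p'
      using nn[OF that(1)] that by (simp add: gd)
    show "card {p \<in> A. nn p = q} \<le> 2" if q: "q \<in> A" for q
    proof (rule ccontr)
      assume "\<not> ?thesis"
      then have "3 \<le> card {p \<in> A. nn p = q}" by simp
      then obtain S where S: "S \<subseteq> {p \<in> A. nn p = q}" "card S = 3"
        by (meson obtain_subset_with_card_n)
      then obtain a b c where abc: "S = {a, b, c}" "a \<noteq> b" "b \<noteq> c" "a \<noteq> c"
        by (auto simp: card_3_iff)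
      have mem: "a \<in> A" "b \<in> A" "c \<in> A" "nn a = q" "nn b = q" "nn c = q" using S abc by auto
      then have "a \<noteq> q" "b \<noteq> q" "c \<noteq> q" using nn by (metis DiffD2 singletonI)+
      then have "distinct [idx a, idx b, idx c, idx q]" using abc mem q idx_inj by simp
      moreover have "cd a q \<le> cd a b" "cd a q \<le> cd a c" "cd b q \<le> cd b a" "cd b q \<le> cd b c"
          "cd c q \<le> cd c a" "cd c q \<le> cd c b"
        using nn[of a] nn[of b] nn[of c] mem abc(2-4) by auto
      moreover have "idx a < length vs" "idx b < length vs" "idx c < length vs" "idx q < length vs"
        using idx mem q by blast+
      ultimately show False
        unfolding cd_def using no_three_nearest_on_circle by blast
    qed
  qed
qed

section \<open>Fallback paths and their halving neighbours\<close>

locale half_greedy_routing = pair_graph G1 for G1 :: "'a pair_pre_digraph" +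
  fixes G2 :: "'a pair_pre_digraph" and nxt :: "'a \<Rightarrow> 'a \<Rightarrow> 'a"
  assumes conn: "Digraph_Component.connected (with_proj G1)"
    and cycle: "cycle_graph G2" "pverts G2 = pverts G1"
    and rule: "fallback_rule G1 nxt"
begin

abbreviation "V \<equiv> pverts G1"
abbreviation "d \<equiv> hop G1"
abbreviation "clustering \<equiv> double_clustering_graph G1 G2"

lemma reach:
  assumes "u \<in> V" "v \<in> V"
  shows "u \<rightarrow>\<^sup>*\<^bsub>with_proj G1\<^esub> v"
proof -
  have "strongly_connected (with_proj G1)"
    using symmetric_connected_imp_strongly_connected[OF sym_arcs conn] .
  then show ?thesis using assms by (auto simp: strongly_connected_def)
qed

lemma gdist_d: "u \<in> V \<Longrightarrow> v \<in> V \<Longrightarrow> gdist G1 u v = ereal (real (d u v))"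
  by (intro gdist_eq_hop reach)

lemma d_triangle: "u \<in> V \<Longrightarrow> v \<in> V \<Longrightarrow> w \<in> V \<Longrightarrow> d u w \<le> d u v + d v w"
  by (intro hop_triangle reach)

lemma d_self: "z \<in> V \<Longrightarrow> d z z = 0"
  using hop_le[of z "[]" z] by (simp add: awalk_Nil_iff)

lemma gball_eq: "z \<in> V \<Longrightarrow> gball G1 r z = {y \<in> V. d z y \<le> r}"
  unfolding gball_def by (auto simp: gdist_d)

lemma clustering_arc_verts: "(x, w) \<in> parcs (clustering \<pi>) \<Longrightarrow> x \<in> V \<and> w \<in> V"
  by (simp add: double_clustering_graph_def)

lemma halving_neighbour_iff:
  assumes "z \<in> V"
  shows "halving_neighbour G1 (clustering \<pi>) z x w \<longleftrightarrow>
    (x, w) \<in> parcs (clustering \<pi>) \<and> 2 * d w z < d x z"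
proof (cases "(x, w) \<in> parcs (clustering \<pi>)")
  case True
  then have xw: "x \<in> V" "w \<in> V" using clustering_arc_verts by blast+
  have "(2::ereal) * ereal (real (d w z)) = ereal (real (2 * d w z))"
    by (simp add: numeral_eq_ereal)
  then have "gdist G1 x z > 2 * gdist G1 w z \<longleftrightarrow> real (2 * d w z) < real (d x z)"
    using xw assms by (simp only: gdist_d less_ereal.simps(1))
  then show ?thesis using True unfolding halving_neighbour_def by (simp only: of_nat_less_iff)
qed (simp add: halving_neighbour_def)

lemma nxt_step:
  assumes "x \<in> V" "z \<in> V" "x \<noteq> z"
  shows "nxt x z \<in> V" "d x z = Suc (d (nxt x z) z)"
proof -
  have arc: "(x, nxt x z) \<in> parcs G1" and dist: "gdist G1 (nxt x z) z = gdist G1 x z - 1"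
    using rule assms unfolding fallback_rule_def by auto
  show V: "nxt x z \<in> V" using in_arcsD2[OF arc] .
  have "real (d (nxt x z) z) = real (d x z) - 1"
    using dist assms V by (simp add: gdist_d one_ereal_def)
  then show "d x z = Suc (d (nxt x z) z)" by linarith
qed

text \<open>
  The path that half-greedy routing follows as long as it meets no halving neighbour.
\<close>

definition descent :: "'a \<Rightarrow> 'a \<Rightarrow> nat \<Rightarrow> 'a" where
  "descent z x i = ((\<lambda>y. nxt y z) ^^ i) x"

lemma descent_0 [simp]: "descent z x 0 = x"
  by (simp add: descent_def)

lemma descent_nxt: "descent z (nxt x z) i = descent z x (Suc i)"
  by (simp only: descent_def funpow_Suc_right comp_apply)

lemma descent_dist:
  assumes "x \<in> V" "z \<in> V" "i \<le> d x z"
  shows "descent z x i \<in> V \<and> d (descent z x i) z = d x z - i"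
  using assms(3)
proof (induction i)
  case 0
  then show ?case using assms by simp
next
  case (Suc i)
  let ?y = "descent z x i"
  have y: "?y \<in> V" "d ?y z = d x z - i" using Suc by auto
  then have "?y \<noteq> z" using Suc.prems assms d_self by auto
  then show ?case using nxt_step[OF y(1) assms(2)] y by (auto simp: descent_def)
qed

lemma inj_on_descent:
  assumes "x \<in> V" "z \<in> V"
  shows "inj_on (descent z x) {..d x z}"
proof (rule inj_onI)
  fix i j assume ij: "i \<in> {..d x z}" "j \<in> {..d x z}" "descent z x i = descent z x j"
  then have "d x z - i = d x z - j"
    using descent_dist[OF assms, of i] descent_dist[OF assms, of j] by simp
  then show "i = j" using ij(1,2) by auto
qed

text \<open>
  The fallback path from \<open>x\<close> visits one vertex at every distance from \<open>z\<close> up to \<open>d x z\<close>.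
\<close>

lemma d_less_card:
  assumes "x \<in> V" "z \<in> V" and A: "finite A" "\<And>y. y \<in> V \<Longrightarrow> d y z \<le> d x z \<Longrightarrow> y \<in> A"
  shows "d x z < card A"
proof -
  have "card {..d x z} \<le> card A"
    using descent_dist[OF assms(1,2)] inj_on_descent[OF assms(1,2)] A
    by (intro card_inj_on_le[of "descent z x"]) auto
  then show ?thesis by simp
qed

definition stuck :: "nat \<Rightarrow> 'a \<Rightarrow> 'a \<Rightarrow> ('a \<Rightarrow> 'a) \<Rightarrow> bool" where
  "stuck K z x \<pi> \<longleftrightarrow> (\<forall>i<K. \<nexists>w. halving_neighbour G1 (clustering \<pi>) z (descent z x i) w)"

text \<open>
  An arc to \<open>v\<close> is only blocked by vertices that are closer to \<open>x\<close> than \<open>v\<close> in the first graph, so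
  it suffices to compare \<open>v\<close> with a set \<open>A\<close> that contains all of these.
\<close>

lemma nearest_is_clustering_arc:
  assumes "x \<in> V" "v \<in> V" "x \<noteq> v"
    and closer: "\<And>w. w \<in> V \<Longrightarrow> d x w < d x v \<Longrightarrow> w \<in> A"
    and nearest: "\<And>w. w \<in> A \<Longrightarrow> w \<noteq> x \<Longrightarrow> gdist G2 (\<pi> x) (\<pi> v) \<le> gdist G2 (\<pi> x) (\<pi> w)"
  shows "(x, v) \<in> parcs (clustering \<pi>)"
  using assms by (auto simp: double_clustering_graph_def gdist_d)

text \<open>
  The ball of radius \<open>r\<close> around \<open>z\<close> is the set to be hit, and the ball of radius \<open>16 r\<close> is the
  set whose arrangement is random. The distance \<open>d y z\<close> has to be large compared with \<open>K\<close> for two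
  reasons: the \<open>K\<close> vertices of the path must all stay far enough from \<open>z\<close> for the small ball to
  halve their distance, and exposing \<open>2 K\<close> elements must leave at least half of both balls unexposed.
\<close>

lemma card_stuck_le:
  fixes c :: real
  assumes c: "1 \<le> c"
    and doubling: "\<And>z r. z \<in> V \<Longrightarrow> 1 \<le> r \<Longrightarrow>
      real (card (gball G1 (2 * r) z)) \<le> c * real (card (gball G1 r z))"
    and y: "y \<in> V" and z: "z \<in> V" and K: "1 \<le> K" "10 * c ^ 4 * K \<le> d y z"
  shows "card {\<pi>. \<pi> permutes V \<and> stuck K z y \<pi>} \<le> (1 - 1 / (8 * c ^ 4)) ^ K * fact (card V)"
proof -
  define D r where "D = d y z" and "r = D div 4"
  \<comment> \<open>A vertex that is closer to some \<open>x\<close> in \<open>X\<close> than a point of \<open>T\<close> is within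
    \<open>D + (D + r) \<le> 9 * r + 6 \<le> 16 * r\<close> of \<open>z\<close>; the doubling condition gives powers of 2.\<close>
  define A T where "A = gball G1 (16 * r) z" and "T = gball G1 r z"
  define X where "X = descent z y ` {..<K}"
  have c4: "1 \<le> c ^ 4" using c by (rule one_le_power)
  have K10: "10 * K \<le> D"
  proof -
    have "10 * real K \<le> 10 * c ^ 4 * real K"
      using mult_right_mono[OF c4, of "real K"] by simp
    then show ?thesis using K(2) unfolding D_def by linarith
  qed
  have r: "1 \<le> r" using K10 K(1) by (simp add: r_def)
  have r_bounds: "4 * r \<le> D" "D < 4 * r + 4" by (simp_all add: r_def)
  have finV: "finite V" using pair_finite_verts .
  have A: "A = {y \<in> V. d z y \<le> 16 * r}" and T: "T = {y \<in> V. d z y \<le> r}"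
    unfolding A_def T_def by (rule gball_eq[OF z])+
  have sub: "T \<subseteq> A" "A \<subseteq> V" "finite A" using finV by (auto simp: A T)
  have X: "x \<in> V" "D - K < d x z" "d x z \<le> D" if "x \<in> X" for x
    using that K10 descent_dist[OF y z] unfolding X_def D_def by auto
  have XA: "X \<subseteq> A"
    using X r_bounds r by (fastforce simp: A hop_sym[of z])
  have cardX: "card X = K"
    unfolding X_def using inj_on_descent[OF y z] K10
    by (subst card_image) (auto simp: D_def intro: inj_on_subset)
  have cardA: "D < card A"
    unfolding D_def using r_bounds r
    by (intro d_less_card y z sub) (auto simp: A hop_sym[of z] D_def)
  have cardT: "card A \<le> c ^ 4 * card T"
  proof -
    have *: "real (card (gball G1 (2 * s) z)) \<le> c ^ Suc n * real (card T)"
      if "real (card (gball G1 s z)) \<le> c ^ n * real (card T)" "1 \<le> s" for s n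
    proof -
      have "real (card (gball G1 (2 * s) z)) \<le> c * real (card (gball G1 s z))"
        using doubling z that(2) .
      also have "\<dots> \<le> c * (c ^ n * real (card T))" using that(1) c by (intro mult_left_mono) auto
      finally show ?thesis by simp
    qed
    have "real (card (gball G1 (2 * (2 * (2 * (2 * r)))) z)) \<le> c ^ Suc (Suc (Suc (Suc 0))) * real (card T)"
      using r by (intro *) (auto simp: T_def)
    moreover have "2 * (2 * (2 * (2 * r))) = 16 * r" "Suc (Suc (Suc (Suc 0))) = 4" by simp_all
    ultimately show ?thesis unfolding A_def by metis
  qed
  define t where "t = 1 / (2 * c ^ 4)"
  have "0 < c ^ 4" "1 \<le> 2 * c ^ 4" using c4 by linarith+
  then have t: "0 \<le> t" "t \<le> 1" by (simp_all add: t_def)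
  have size: "t * card A + 2 * card X + 1 \<le> card T"
  proof -
    have "c ^ 4 * (2 * K + 1) \<le> c ^ 4 * (3 * K)"
      using c4 K by (intro mult_left_mono) auto
    also have "\<dots> \<le> card A / 2" using K(2) cardA unfolding D_def by (simp add: field_simps)
    finally have "c ^ 4 * (t * card A + 2 * K + 1) \<le> card A"
      using c4 by (simp add: t_def field_simps)
    also have "\<dots> \<le> c ^ 4 * card T" by (rule cardT)
    finally show ?thesis using \<open>0 < c ^ 4\<close> unfolding cardX by (rule mult_left_le_imp_le)
  qed
  have "card {\<tau>. \<tau> permutes A \<and> stuck K z y (\<pi> \<circ> \<tau>)} \<le> (1 - t / 4) ^ K * fact (card A)"
    if \<pi>: "\<pi> permutes V" for \<pi>
  proof -
    have "2 \<le> card A" using cardA K10 K by linarith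
    moreover have "inj_on \<pi> A" using permutes_inj[OF \<pi>] inj_on_subset by blast
    moreover have "\<pi> ` A \<subseteq> pverts G2"
      using sub cycle(2) permutes_in_image[OF \<pi>] by auto
    ultimately obtain nn where nn: "\<And>p. p \<in> A \<Longrightarrow> nn p \<in> A \<and> nn p \<noteq> p"
      "\<And>p p'. p \<in> A \<Longrightarrow> p' \<in> A \<Longrightarrow> p' \<noteq> p \<Longrightarrow>
           gdist G2 (\<pi> p) (\<pi> (nn p)) \<le> gdist G2 (\<pi> p) (\<pi> p')"
      "\<And>q. q \<in> A \<Longrightarrow> card {p \<in> A. nn p = q} \<le> 2"
      using nearest_map_on_cycle[OF cycle(1) sub(3)] by blast
    have "{\<tau>. \<tau> permutes A \<and> stuck K z y (\<pi> \<circ> \<tau>)} \<subseteq>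
        {\<tau>. \<tau> permutes A \<and> (\<forall>x\<in>X. inv \<tau> (nn (\<tau> x)) \<notin> T)}"
    proof safe
      fix \<tau> x assume \<tau>: "\<tau> permutes A" and stuck: "stuck K z y (\<pi> \<circ> \<tau>)"
        and x: "x \<in> X" and hit: "inv \<tau> (nn (\<tau> x)) \<in> T"
      define v where "v = inv \<tau> (nn (\<tau> x))"
      have \<tau>v: "\<tau> v = nn (\<tau> x)" unfolding v_def using permutes_inverses(1)[OF \<tau>] .
      have xA: "x \<in> A" using x XA by auto
      then have \<tau>x: "\<tau> x \<in> A" using permutes_in_image[OF \<tau>] by simp
      have v: "v \<in> V" "d z v \<le> r" using hit by (auto simp: T v_def)
      have neq: "x \<noteq> v" using \<tau>v nn(1)[OF \<tau>x] by auto
      have "(x, v) \<in> parcs (clustering (\<pi> \<circ> \<tau>))"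
      proof (rule nearest_is_clustering_arc[where A = A])
        fix w assume w: "w \<in> V" "d x w < d x v"
        have "d z w \<le> d z x + d x w" using d_triangle z X(1)[OF x] w(1) by blast
        also have "d x w \<le> d x z + d z v"
          using w d_triangle[OF X(1)[OF x] z v(1)] by linarith
        finally show "w \<in> A" using X(3)[OF x] v(2) w(1) r_bounds r hop_sym[of z x] unfolding A by simp
      next
        fix w assume w: "w \<in> A" "w \<noteq> x"
        then have "\<tau> w \<in> A" "\<tau> w \<noteq> \<tau> x"
          using permutes_in_image[OF \<tau>] permutes_inj[OF \<tau>] by (auto dest: injD)
        then show "gdist G2 ((\<pi> \<circ> \<tau>) x) ((\<pi> \<circ> \<tau>) v) \<le> gdist G2 ((\<pi> \<circ> \<tau>) x) ((\<pi> \<circ> \<tau>) w)"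
          using nn(2)[OF \<tau>x] by (simp add: \<tau>v)
      qed (use X[OF x] v neq in auto)
      moreover have "2 * d v z < d x z"
        using X(2)[OF x] v(2) r_bounds K10 r hop_sym[of z v] by linarith
      ultimately have "halving_neighbour G1 (clustering (\<pi> \<circ> \<tau>)) z x v"
        using z by (simp add: halving_neighbour_iff)
      then show False using stuck x by (auto simp: stuck_def X_def)
    qed
    then have "card {\<tau>. \<tau> permutes A \<and> stuck K z y (\<pi> \<circ> \<tau>)} \<le>
        card {\<tau>. \<tau> permutes A \<and> (\<forall>x\<in>X. inv \<tau> (nn (\<tau> x)) \<notin> T)}"
      using finite_permutations[OF sub(3)] by (intro card_mono) (auto intro: finite_subset)
    also have "real \<dots> \<le> (1 - t / 4) ^ card X * fact (card A)"
      using nn sub XA t size K10 cardA by (intro card_missing_perms) (auto simp: cardX)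
    finally show ?thesis by (simp add: cardX)
  qed
  then have "card {\<pi>. \<pi> permutes V \<and> stuck K z y \<pi>} \<le> (1 - t / 4) ^ K * fact (card V)"
    by (rule card_permutes_by_cosets[OF finV sub(2)])
  then show ?thesis by (simp add: t_def)
qed

section \<open>Length of a route\<close>

lemma path_length_le_dist:
  assumes "half_greedy_path G1 (clustering \<pi>) nxt z p" "z \<in> V" "hd p \<in> V"
  shows "length p \<le> Suc (d (hd p) z)"
  using assms
proof (induction rule: half_greedy_path.induct)
  case (halve x w p)
  then have "(x, w) \<in> parcs (clustering \<pi>)" "2 * d w z < d x z"
    by (simp_all add: halving_neighbour_iff)
  then show ?case using halve clustering_arc_verts by fastforce
next
  case (fallback x p)
  then show ?case using nxt_step[of x z] by fastforce
qed (simp)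

text \<open>
  The number \<open>j\<close> bounds the fallback steps left before the next halving step; it drops by one in a
  fallback step and is reset to at most \<open>K - 1\<close> by a halving step, which pays for the reset because
  the logarithm of the distance drops by at least one. At distance \<open>D0\<close> or less, at most \<open>D0\<close>
  steps remain in any case. The length of a path counts its vertices, one more than its steps.
\<close>

lemma path_length_if_not_stuck:
  assumes "half_greedy_path G1 (clustering \<pi>) nxt z p" "z \<in> V" "hd p \<in> V"
    and "d (hd p) z \<le> D0 \<or> \<not> stuck (Suc j) z (hd p) \<pi>"
    and "\<And>y. y \<in> V \<Longrightarrow> D0 < d y z \<Longrightarrow> \<not> stuck K z y \<pi>" "1 \<le> K"
  shows "real (length p) \<le> real (D0 + j + 2) + K * log 2 (d (hd p) z)"
  using assms
proof (induction arbitrary: j rule: half_greedy_path.induct)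
  case stop
  then show ?case using d_self by (simp add: log_def)
next
  case (halve x w p)
  have arc: "(x, w) \<in> parcs (clustering \<pi>)" and less: "2 * d w z < d x z"
    using halve by (simp_all add: halving_neighbour_iff)
  have w: "w \<in> V" using clustering_arc_verts[OF arc] by simp
  have Lx: "0 \<le> K * log 2 (d x z)" using less by simp
  show ?case
  proof (cases "d w z \<le> D0")
    case True
    have "length (w # p) \<le> Suc (d w z)"
      using path_length_le_dist[OF halve.hyps(3) halve.prems(1)] w by simp
    then show ?thesis using True Lx by simp
  next
    case False
    have "real (length (w # p)) \<le> real (D0 + (K - 1) + 2) + K * log 2 (d w z)"
      using halve.IH[of "K - 1"] halve.prems w False by simp
    also have "\<dots> = real (D0 + 1) + K * (1 + log 2 (d w z))"
      using halve.prems(5) by (simp add: of_nat_diff algebra_simps)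
    also have "1 + log 2 (d w z) = log 2 (2 * d w z)" using False by (simp add: log_mult)
    also have "real (D0 + 1) + K * log 2 (2 * d w z) \<le> real (D0 + 1) + K * log 2 (d x z)"
      using less False by (intro add_left_mono mult_left_mono) auto
    finally show ?thesis by simp
  qed
next
  case (fallback x p)
  let ?y = "nxt x z"
  have x: "x \<in> V" using fallback.prems by simp
  have y: "?y \<in> V" "d x z = Suc (d ?y z)" using nxt_step[OF x fallback.prems(1) fallback.hyps(1)] .
  have Lx: "0 \<le> K * log 2 (d x z)" using y(2) by simp
  show ?case
  proof (cases "d ?y z \<le> D0")
    case True
    have "length (?y # p) \<le> Suc (d ?y z)"
      using path_length_le_dist[OF fallback.hyps(3) fallback.prems(1)] y by simp
    then show ?thesis using True Lx by simp
  next
    case False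
    then have "\<not> stuck (Suc j) z x \<pi>" using fallback.prems(3) y(2) by auto
    then obtain i where i: "i < Suc j" "\<exists>w. halving_neighbour G1 (clustering \<pi>) z (descent z x i) w"
      by (auto simp: stuck_def)
    then have "i \<noteq> 0" using fallback.hyps(2) by (metis descent_0)
    then obtain i' where i': "i = Suc i'" using not0_implies_Suc by blast
    then obtain j' where j': "j = Suc j'" using i(1) by (cases j) auto
    have "\<not> stuck (Suc j') z ?y \<pi>"
      using i i' j' unfolding stuck_def descent_nxt by auto
    then have "real (length (?y # p)) \<le> real (D0 + j' + 2) + K * log 2 (d ?y z)"
      using fallback.IH[of j'] fallback.prems y(1) by simp
    also have "\<dots> \<le> real (D0 + j' + 2) + K * log 2 (d x z)"
      using False y(2) by (intro add_left_mono mult_left_mono) auto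
    finally show ?thesis using j' by simp
  qed
qed

end

section \<open>Expected length\<close>

lemma real_nat_ceiling_le: "0 \<le> x \<Longrightarrow> real (nat \<lceil>x\<rceil>) \<le> x + 1"
  by linarith

context half_greedy_routing
begin

text \<open>
  The constants: \<open>K\<close> is the least natural number for which the bound
  \<open>(1 - 1 / (8 c\<^sup>4)) ^ K \<le> exp (- K / (8 c\<^sup>4))\<close> on the probability of being stuck is at most
  \<open>1 / n\<^sup>2\<close>, and \<open>D0\<close> is the least distance to which this bound applies. They are at most
  \<open>17 c\<^sup>4 ln n\<close> and \<open>11 c\<^sup>4 K\<close>, so the length \<open>D0 + K + K log\<^sub>2 n\<close> of a route without stuck
  vertices is at most \<open>17 * 14 * c\<^sup>8 (ln n)\<^sup>2\<close>; the routes of the remaining permutations add 1 to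
  the average.
\<close>

lemma sum_route_length_le:
  fixes c :: real and route :: "('a \<Rightarrow> 'a) \<Rightarrow> 'a list"
  assumes c: "1 \<le> c"
    and doubling: "\<And>z r. z \<in> V \<Longrightarrow> 1 \<le> r \<Longrightarrow>
      real (card (gball G1 (2 * r) z)) \<le> c * real (card (gball G1 r z))"
    and x: "x \<in> V" and z: "z \<in> V" and n: "3 \<le> card V"
    and route: "\<And>\<pi>. \<pi> permutes V \<Longrightarrow> half_greedy_path G1 (clustering \<pi>) nxt z (x # route \<pi>)"
  shows "(\<Sum>\<pi> | \<pi> permutes V. real (length (route \<pi>)))
    \<le> 239 * c ^ 8 * (ln (card V))\<^sup>2 * fact (card V)"
proof -
  define n L where "n = card V" and "L = ln (real n)"
  define K where "K = nat \<lceil>16 * c ^ 4 * L\<rceil>"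
  define D0 where "D0 = nat \<lceil>10 * c ^ 4 * K\<rceil>"
  define Perms where "Perms = {\<pi>. \<pi> permutes V}"
  define Bad where "Bad = (\<Union>y\<in>{y \<in> V. D0 < d y z}. {\<pi>. \<pi> permutes V \<and> stuck K z y \<pi>})"
  have finV: "finite V" using pair_finite_verts .
  have finPerms: "finite Perms" "card Perms = fact n"
    using finV by (simp_all add: Perms_def finite_permutations card_permutations n_def)
  have BadPerms: "Bad \<subseteq> Perms" by (auto simp: Bad_def Perms_def)
  have L: "1 \<le> L"
  proof -
    have "exp 1 \<le> real n" using exp_le n unfolding n_def by linarith
    then show ?thesis using n unfolding L_def n_def by (subst ln_ge_iff) auto
  qed
  have c4: "1 \<le> c ^ 4" using c by (rule one_le_power)
  have c8: "c ^ 8 = c ^ 4 * c ^ 4" by (simp add: power_add[symmetric])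
  have c4L: "1 \<le> c ^ 4 * L" using mult_mono[OF c4 L] c4 by simp
  have K: "16 * c ^ 4 * L \<le> K" "K \<le> 17 * c ^ 4 * L" "1 \<le> K"
  proof -
    show "16 * c ^ 4 * L \<le> K" unfolding K_def by (rule real_nat_ceiling_ge)
    then show "1 \<le> K" using c4L by linarith
    have "real K \<le> 16 * c ^ 4 * L + 1"
      unfolding K_def using c4L by (intro real_nat_ceiling_le) linarith
    then show "K \<le> 17 * c ^ 4 * L" using c4L by linarith
  qed
  have D0: "10 * c ^ 4 * K \<le> D0" "D0 \<le> 11 * c ^ 4 * K"
  proof -
    show "10 * c ^ 4 * K \<le> D0" unfolding D0_def by (rule real_nat_ceiling_ge)
    have "1 \<le> c ^ 4 * real K" using mult_mono[OF c4, of 1 "real K"] c4 K(3) by simp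
    moreover have "real D0 \<le> 10 * c ^ 4 * K + 1"
      unfolding D0_def using c4 by (intro real_nat_ceiling_le) simp
    ultimately show "D0 \<le> 11 * c ^ 4 * K" by linarith
  qed
  have tail: "(1 - 1 / (8 * c ^ 4)) ^ K \<le> 1 / (real n)\<^sup>2"
  proof -
    define e where "e = 1 / (8 * c ^ 4)"
    have "1 \<le> 8 * c ^ 4" "0 < 8 * c ^ 4" using c4 by linarith+
    then have "e \<le> 1" unfolding e_def by (subst divide_le_eq_1_pos)
    then have "(1 - e) ^ K \<le> exp (- e) ^ K"
      using exp_ge_add_one_self[of "- e"] by (intro power_mono) auto
    also have "\<dots> = exp (- (K * e))" by (simp add: exp_of_nat_mult[symmetric])
    also have "\<dots> \<le> exp (- (2 * L))"
    proof -
      have "16 * c ^ 4 * L * e \<le> K * e" using K(1) c4 by (intro mult_right_mono) (auto simp: e_def)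
      moreover have "16 * c ^ 4 * L * e = 2 * L" using c by (simp add: e_def)
      ultimately show ?thesis by simp
    qed
    also have "\<dots> = 1 / (exp L)\<^sup>2"
      by (simp only: exp_minus exp_double inverse_eq_divide)
    also have "exp L = real n" using n by (simp add: L_def n_def)
    finally show ?thesis unfolding e_def .
  qed
  have card_Bad: "real n * card Bad \<le> fact n"
  proof -
    have "card Bad \<le> (\<Sum>y | y \<in> V \<and> D0 < d y z. card {\<pi>. \<pi> permutes V \<and> stuck K z y \<pi>})"
      unfolding Bad_def using finV by (intro card_UN_le) auto
    then have "real (card Bad) \<le> (\<Sum>y | y \<in> V \<and> D0 < d y z. real (card {\<pi>. \<pi> permutes V \<and> stuck K z y \<pi>}))"
      unfolding of_nat_sum[symmetric] of_nat_le_iff .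
    also have "\<dots> \<le> (\<Sum>y | y \<in> V \<and> D0 < d y z. 1 / (real n)\<^sup>2 * fact n)"
    proof (intro sum_mono)
      fix y assume y: "y \<in> {y \<in> V. D0 < d y z}"
      then have "real D0 \<le> d y z" by simp
      then have "10 * c ^ 4 * K \<le> d y z" using D0(1) by linarith
      then have "card {\<pi>. \<pi> permutes V \<and> stuck K z y \<pi>} \<le> (1 - 1 / (8 * c ^ 4)) ^ K * fact n"
        unfolding n_def using y by (intro card_stuck_le[OF c doubling _ z K(3)]) simp_all
      also have "\<dots> \<le> 1 / (real n)\<^sup>2 * fact n" using tail by (intro mult_right_mono) auto
      finally show "card {\<pi>. \<pi> permutes V \<and> stuck K z y \<pi>} \<le> 1 / (real n)\<^sup>2 * fact n" .
    qed
    also have "\<dots> = card {y \<in> V. D0 < d y z} * (1 / (real n)\<^sup>2 * fact n)" by simp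
    also have "\<dots> \<le> real n * (1 / (real n)\<^sup>2 * fact n)"
      using finV unfolding n_def by (intro mult_right_mono) (auto intro!: card_mono)
    finally have "real n * card Bad \<le> real n * (real n * (1 / (real n)\<^sup>2 * fact n))"
      by (rule mult_left_mono) simp
    also have "\<dots> = fact n"
    proof -
      have "real n \<noteq> 0" using n unfolding n_def by linarith
      then show ?thesis by (simp add: power2_eq_square)
    qed
    finally show ?thesis .
  qed
  have dn: "d x z < n"
    unfolding n_def using d_less_card[OF x z finV] by blast
  have short: "length (route \<pi>) \<le> n" if "\<pi> \<in> Perms" for \<pi>
    using path_length_le_dist[OF route z] that x dn by (force simp: Perms_def)
  define M where "M = 238 * c ^ 8 * L\<^sup>2"
  have good: "length (route \<pi>) \<le> M" if "\<pi> \<in> Perms - Bad" for \<pi>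
  proof -
    have \<pi>: "\<pi> permutes V" using that by (simp add: Perms_def)
    have "\<not> stuck K z y \<pi>" if "y \<in> V" "D0 < d y z" for y
      using that \<open>\<pi> \<in> Perms - Bad\<close> by (auto simp: Bad_def Perms_def)
    then have "real (length (x # route \<pi>)) \<le> real (D0 + (K - 1) + 2) + K * log 2 (d (hd (x # route \<pi>)) z)"
      using K(3) x z by (intro path_length_if_not_stuck[OF route[OF \<pi>]]) (auto simp: not_le)
    then have "real (length (route \<pi>)) \<le> D0 + K + K * log 2 (d x z)"
      using K(3) by (simp add: of_nat_diff)
    also have "\<dots> \<le> D0 + K + K * (2 * L)"
    proof -
      have "log 2 (d x z) \<le> log 2 n"
      proof (cases "d x z = 0")
        case True
        have "0 \<le> log 2 n" using L by (simp add: log_def L_def)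
        then show ?thesis using True by (simp add: log_def)
      next
        case False
        then show ?thesis using dn by (subst log_le_cancel_iff) auto
      qed
      also have "\<dots> \<le> 2 * L"
      proof -
        have "L * 1 \<le> L * (2 * ln 2)" using ln2_ge_two_thirds L by (intro mult_left_mono) auto
        then show ?thesis by (simp add: log_def L_def field_simps)
      qed
      finally show ?thesis by (intro add_left_mono mult_left_mono) auto
    qed
    also have "\<dots> \<le> 11 * c ^ 4 * K + K + K * (2 * L)" using D0 by simp
    also have "\<dots> = K * (11 * c ^ 4 + 1 + 2 * L)" by (simp add: algebra_simps)
    also have "\<dots> \<le> (17 * c ^ 4 * L) * (14 * (c ^ 4 * L))"
    proof (intro mult_mono K(2))
      have "c ^ 4 \<le> c ^ 4 * L" "L \<le> c ^ 4 * L"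
        using mult_left_mono[OF L, of "c ^ 4"] mult_right_mono[OF c4, of L] L c4 by simp_all
      then show "11 * c ^ 4 + 1 + 2 * L \<le> 14 * (c ^ 4 * L)" using c4 by linarith
    qed (use c4 L in auto)
    also have "\<dots> = M" unfolding M_def c8 power2_eq_square by simp
    finally show ?thesis .
  qed
  have "(\<Sum>\<pi>\<in>Perms. real (length (route \<pi>))) =
      (\<Sum>\<pi>\<in>Perms - Bad. real (length (route \<pi>))) + (\<Sum>\<pi>\<in>Bad. real (length (route \<pi>)))"
    using sum.subset_diff[OF BadPerms finPerms(1)] .
  also have "\<dots> \<le> (\<Sum>\<pi>\<in>Perms - Bad. M) + (\<Sum>\<pi>\<in>Bad. real n)"
    using good short BadPerms by (intro add_mono sum_mono) auto
  also have "\<dots> \<le> fact n * M + fact n * 1"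
  proof (intro add_mono)
    have "0 \<le> M" unfolding M_def using c by simp
    moreover have "real (card (Perms - Bad)) \<le> fact n"
      using card_mono[OF finPerms(1), of "Perms - Bad"] finPerms(2) by (metis Diff_subset of_nat_fact of_nat_le_iff)
    ultimately show "(\<Sum>\<pi>\<in>Perms - Bad. M) \<le> fact n * M" by (simp add: mult_right_mono)
    show "(\<Sum>\<pi>\<in>Bad. real n) \<le> fact n * 1" using card_Bad by (simp add: mult.commute)
  qed
  also have "\<dots> \<le> fact n * (239 * c ^ 8 * L\<^sup>2)"
  proof -
    have "1 \<le> c ^ 8 * L\<^sup>2"
      using mult_mono[OF one_le_power[OF c, of 8] one_le_power[OF L, of 2]] c by simp
    then have "M + 1 \<le> 239 * c ^ 8 * L\<^sup>2" unfolding M_def by linarith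
    then have "fact n * (M + 1) \<le> fact n * (239 * c ^ 8 * L\<^sup>2)" by (intro mult_left_mono) simp_all
    then show ?thesis by (simp only: distrib_left)
  qed
  also have "\<dots> = 239 * c ^ 8 * L\<^sup>2 * fact n" by (rule mult.commute)
  finally show ?thesis unfolding Perms_def n_def L_def .
qed

end

theorem theorem5p6:
  fixes F :: "'a pair_pre_digraph set"
  assumes "\<forall>G\<in>F. pair_graph G"
    and "bounded_doubling_dimension F"
  shows "\<exists>C::real. \<forall>G1 G2 nxt.
    G1 \<in> F \<longrightarrow> Digraph_Component.connected (with_proj G1) \<longrightarrow> card (pverts G1) \<ge> 3 \<longrightarrow>
    cycle_graph G2 \<longrightarrow> pverts G2 = pverts G1 \<longrightarrow>
    fallback_rule G1 nxt \<longrightarrow>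
    (\<forall>x\<in>pverts G1. \<forall>z\<in>pverts G1. \<forall>route :: ('a \<Rightarrow> 'a) \<Rightarrow> 'a list.
      (\<forall>\<pi>. \<pi> permutes pverts G1 \<longrightarrow>
        half_greedy_path G1 (double_clustering_graph G1 G2 \<pi>) nxt z (x # route \<pi>)) \<longrightarrow>
      measure_pmf.expectation (pmf_of_set {\<pi>. \<pi> permutes pverts G1})
        (\<lambda>\<pi>. real (length (route \<pi>)))
      \<le> C * (ln (real (card (pverts G1))))\<^sup>2)"
proof -
  from assms(2) obtain c0 :: real where c0: "\<And>G u v r. G \<in> F \<Longrightarrow> u \<in> pverts G \<Longrightarrow> v \<in> pverts G \<Longrightarrow>
      1 \<le> r \<Longrightarrow> gball G r u \<subseteq> gball G (2 * r) v \<Longrightarrow>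
      real (card (gball G (2 * r) v)) \<le> c0 * real (card (gball G r u))"
    unfolding bounded_doubling_dimension_def by blast
  define c where "c = max c0 1"
  show ?thesis
  proof (intro exI[of _ "239 * c ^ 8"] allI impI ballI)
    fix G1 G2 nxt x z and route :: "('a \<Rightarrow> 'a) \<Rightarrow> 'a list"
    assume G1: "G1 \<in> F" "Digraph_Component.connected (with_proj G1)" "card (pverts G1) \<ge> 3"
      and G2: "cycle_graph G2" "pverts G2 = pverts G1"
      and rule: "fallback_rule G1 nxt" and xz: "x \<in> pverts G1" "z \<in> pverts G1"
      and route: "\<forall>\<pi>. \<pi> permutes pverts G1 \<longrightarrow>
        half_greedy_path G1 (double_clustering_graph G1 G2 \<pi>) nxt z (x # route \<pi>)"
    interpret pair_graph G1 using assms(1) G1(1) by blast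
    interpret half_greedy_routing G1 G2 nxt
      using G1 G2 rule by unfold_locales
    have doubling: "real (card (gball G1 (2 * r) v)) \<le> c * real (card (gball G1 r v))"
      if "v \<in> V" "1 \<le> r" for v r
    proof -
      have "gball G1 r v \<subseteq> gball G1 (2 * r) v"
        using that by (auto simp: gball_eq)
      then have "real (card (gball G1 (2 * r) v)) \<le> c0 * real (card (gball G1 r v))"
        using c0 G1(1) that by blast
      also have "\<dots> \<le> c * real (card (gball G1 r v))"
        by (intro mult_right_mono) (auto simp: c_def)
      finally show ?thesis .
    qed
    let ?P = "{\<pi>. \<pi> permutes V}"
    have "measure_pmf.expectation (pmf_of_set ?P) (\<lambda>\<pi>. real (length (route \<pi>)))
        = (\<Sum>\<pi>\<in>?P. real (length (route \<pi>))) / real (card ?P)"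
      using finite_permutations[OF pair_finite_verts] permutes_id[of V]
      by (intro integral_pmf_of_set) blast+
    also have "card ?P = fact (card V)"
      using card_permutations[OF refl pair_finite_verts] .
    also have "(\<Sum>\<pi>\<in>?P. real (length (route \<pi>))) / real (fact (card V))
        \<le> (239 * c ^ 8 * (ln (card V))\<^sup>2 * fact (card V)) / real (fact (card V))"
    proof (rule divide_right_mono)
      have c1: "1 \<le> c" by (simp add: c_def)
      show "(\<Sum>\<pi>\<in>?P. real (length (route \<pi>))) \<le> 239 * c ^ 8 * (ln (card V))\<^sup>2 * fact (card V)"
        by (rule sum_route_length_le[OF c1 doubling xz G1(3) route[rule_format]])
    qed simp
    also have "\<dots> = 239 * c ^ 8 * (ln (card V))\<^sup>2" by simp
    finally show "measure_pmf.expectation (pmf_of_set ?P) (\<lambda>\<pi>. real (length (route \<pi>)))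
        \<le> 239 * c ^ 8 * (ln (real (card V)))\<^sup>2" .
  qed
qed

end
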